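(* Let $(\alpha : A \to R \leftarrow B : \beta,\ \iota : R \to B\otimes A)$ be a bilinear factorization structure in an arbitrary bicategory $\mathcal K$. Then the 2-cell $$\Psi := \big( A\otimes B \xrightarrow{\ \alpha\otimes\beta\ } R\otimes R \xrightarrow{\ \mu_R\ } R \xrightarrow{\ \iota\ } B\otimes A\big)$$ is a weak distributive law of $A$ over $B$ such that the corresponding idempotent 2-cell $\overline\Psi : B\otimes A\to B\otimes A$ splits. Moreover, $R$ is isomorphic, as a unital monad, to the corresponding unital monad $B\otimes_\Psi A$ (the weak wreath product).
   Context: Work in a bicategory $\mathcal K$ whose coherence isomorphisms are suppressed. Horizontal composition is denoted by $\otimes$ (for composable 1-cells, $M\otimes N$ means "first $N$, then $M$") and vertical composition of 2-cells by juxtaposition. A 1-cell name also denotes its identity 2-cell. A (unital) monad $(A,\mu_A,\eta_A)$ on an object $k$ is a 1-cell $A:k\to k$ with an associative multiplication $\mu_A:A\otimes A\to A$ and unit $\eta_A:k\to A$ (where $k$ also denotes the identity 1-cell). **Weak distributive law.** For monads $A$, $B$ on the same object, a 2-cell $\Psi:A\otimes B\to B\otimes A$ is a weak distributive law of $A$ over $B$ if - $\Psi(\mu_A\otimes B)=(B\otimes\mu_A)(\Psi\otimes A)(A\otimes\Psi)$, - $\Psi(A\otimes\mu_B)=(\mu_B\otimes A)(B\otimes\Psi)(\Psi\otimes B)$, - $(\mu_B\otimes A)(B\otimes\Psi)(B\otimes A\otimes\eta_B)=(B\otimes\mu_A)(\Psi\otimes A)(\eta_A\otimes B\otimes A)$.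 **Associated idempotent and weak wreath product.** For a weak distributive law $\Psi$, put $\mu:=(\mu_B\otimes\mu_A)(B\otimes\Psi\otimes A):B\otimes A\otimes B\otimes A\to B\otimes A$, an associative (possibly non-unital) multiplication. The 2-cell $\overline\Psi:=\mu(B\otimes\eta_A\otimes\eta_B\otimes A):B\otimes A\to B\otimes A$ is idempotent; it is also equal to both sides of the third identity above. It splits if there are a 1-cell $B\otimes_\Psi A$ and 2-cells $\pi_\Psi:B\otimes A\to B\otimes_\Psi A$ and $\iota_\Psi:B\otimes_\Psi A\to B\otimes A$ such that $\pi_\Psi\iota_\Psi$ is the identity and $\iota_\Psi\pi_\Psi=\overline\Psi$. In this case $B\otimes_\Psi A$ is a unital monad with multiplication $\mu_\Psi:=\pi_\Psi\,\mu\,(\iota_\Psi\otimes\iota_\Psi)$ and unit $\eta_\Psi:=\pi_\Psi(\eta_B\otimes\eta_A)$; it is determined uniquely up to isomorphism and is called the weak wreath product. **Bilinear factorization structure.** Let $A$, $B$, $R$ be unital monads on the same object of $\mathcal K$, and let $\alpha:A\to R$ and $\beta:B\to R$ be 2-cells that are morphisms of unital monads: $\alpha\mu_A=\mu_R(\alpha\otimes\alpha)$, $\alpha\eta_A=\eta_R$, $\beta\mu_B=\mu_R(\beta\otimes\beta)$, $\beta\eta_B=\eta_R$. Regard $R$ as a $B$-$A$ bimodule via the left $B$-action $\mu_R(\beta\otimes R)$ and the right $A$-action $\mu_R(R\otimes\alpha)$, and regard $B\otimes A$ as a $B$-$A$ bimodule via $\mu_B\otimes A$ and $B\otimes\mu_A$.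 Then $\pi:=\mu_R(\beta\otimes\alpha):B\otimes A\to R$ is a morphism of $B$-$A$ bimodules. If $\iota:R\to B\otimes A$ is a morphism of $B$-$A$ bimodules with $\pi\iota=R$ (the identity 2-cell of $R$), then the datum $(\alpha:A\to R\leftarrow B:\beta,\ \iota:R\to B\otimes A)$ is called a bilinear factorization structure on $R$. *)

theory Defs
  imports Main
begin

section \<open>Bicategories\<close>

text \<open>
  Horizontal composition is written in applicative order: for 1-cells \<open>N : a \<rightarrow> b\<close> and
  \<open>M : b \<rightarrow> c\<close>, the 1-cell \<open>M \<otimes> N : a \<rightarrow> c\<close> is ``first \<open>N\<close>, then \<open>M\<close>''.
  The symbol \<open>\<star>\<close> is horizontal composition of 2-cells, \<open>\<cdot>\<close> is vertical composition
  (\<open>\<tau> \<cdot> \<sigma>\<close> is ``first \<open>\<sigma>\<close>, then \<open>\<tau>\<close>''), and \<open>\<guillemotleft>M\<guillemotright>\<close> is the identity 2-cell of the 1-cell \<open>M\<close>.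
\<close>

record ('o, 'm, 'c) bicat =
  Obj   :: "'o set"
  Cell1 :: "'m set"
  Cell2 :: "'c set"
  src   :: "'m \<Rightarrow> 'o"
  trg   :: "'m \<Rightarrow> 'o"
  dom2  :: "'c \<Rightarrow> 'm"
  cod2  :: "'c \<Rightarrow> 'm"
  id1   :: "'o \<Rightarrow> 'm"
  comp1 :: "'m \<Rightarrow> 'm \<Rightarrow> 'm" (infix "\<otimes>\<index>" 70)
  id2   :: "'m \<Rightarrow> 'c" ("\<guillemotleft>_\<guillemotright>\<index>")
  vcomp :: "'c \<Rightarrow> 'c \<Rightarrow> 'c" (infixr "\<cdot>\<index>" 55)
  hcomp :: "'c \<Rightarrow> 'c \<Rightarrow> 'c" (infix "\<star>\<index>" 70)
  assoc :: "'m \<Rightarrow> 'm \<Rightarrow> 'm \<Rightarrow> 'c"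
  lunit :: "'m \<Rightarrow> 'c"
  runit :: "'m \<Rightarrow> 'c"

definition hom1 :: "('o, 'm, 'c, 'x) bicat_scheme \<Rightarrow> 'o \<Rightarrow> 'o \<Rightarrow> 'm set" where
  "hom1 K a b = {M \<in> Cell1 K. src K M = a \<and> trg K M = b}"

definition hom2 :: "('o, 'm, 'c, 'x) bicat_scheme \<Rightarrow> 'm \<Rightarrow> 'm \<Rightarrow> 'c set" where
  "hom2 K M N = {\<sigma> \<in> Cell2 K. dom2 K \<sigma> = M \<and> cod2 K \<sigma> = N}"

definition inverse2 :: "('o, 'm, 'c, 'x) bicat_scheme \<Rightarrow> 'c \<Rightarrow> 'c \<Rightarrow> bool" where
  "inverse2 K \<sigma> \<tau> \<longleftrightarrow>
     \<tau> \<in> hom2 K (cod2 K \<sigma>) (dom2 K \<sigma>) \<and>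
     \<tau> \<cdot> \<sigma> = \<guillemotleft>dom2 K \<sigma>\<guillemotright> \<and> \<sigma> \<cdot> \<tau> = \<guillemotleft>cod2 K \<sigma>\<guillemotright>" for K (structure)

definition iso2 :: "('o, 'm, 'c, 'x) bicat_scheme \<Rightarrow> 'c \<Rightarrow> bool" where
  "iso2 K \<sigma> \<longleftrightarrow> \<sigma> \<in> Cell2 K \<and> (\<exists>\<tau>. inverse2 K \<sigma> \<tau>)"

definition inv2 :: "('o, 'm, 'c, 'x) bicat_scheme \<Rightarrow> 'c \<Rightarrow> 'c" where
  "inv2 K \<sigma> = (THE \<tau>. inverse2 K \<sigma> \<tau>)"

abbreviation assoc_inv :: "('o, 'm, 'c, 'x) bicat_scheme \<Rightarrow> 'm \<Rightarrow> 'm \<Rightarrow> 'm \<Rightarrow> 'c" where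
  "assoc_inv K M N P \<equiv> inv2 K (assoc K M N P)"

abbreviation lunit_inv :: "('o, 'm, 'c, 'x) bicat_scheme \<Rightarrow> 'm \<Rightarrow> 'c" where
  "lunit_inv K M \<equiv> inv2 K (lunit K M)"

abbreviation runit_inv :: "('o, 'm, 'c, 'x) bicat_scheme \<Rightarrow> 'm \<Rightarrow> 'c" where
  "runit_inv K M \<equiv> inv2 K (runit K M)"

locale bicategory =
  fixes K :: "('o, 'm, 'c, 'x) bicat_scheme" (structure)
  assumes src_Obj: "M \<in> Cell1 K \<Longrightarrow> src K M \<in> Obj K"
    and trg_Obj: "M \<in> Cell1 K \<Longrightarrow> trg K M \<in> Obj K"
    and dom2_Cell1: "\<sigma> \<in> Cell2 K \<Longrightarrow> dom2 K \<sigma> \<in> Cell1 K"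
    and cod2_Cell1: "\<sigma> \<in> Cell2 K \<Longrightarrow> cod2 K \<sigma> \<in> Cell1 K"
    and src_parallel: "\<sigma> \<in> Cell2 K \<Longrightarrow> src K (dom2 K \<sigma>) = src K (cod2 K \<sigma>)"
    and trg_parallel: "\<sigma> \<in> Cell2 K \<Longrightarrow> trg K (dom2 K \<sigma>) = trg K (cod2 K \<sigma>)"
    and id2_hom: "M \<in> Cell1 K \<Longrightarrow> \<guillemotleft>M\<guillemotright> \<in> hom2 K M M"
    and vcomp_hom: "\<lbrakk>\<sigma> \<in> hom2 K L M; \<tau> \<in> hom2 K M N\<rbrakk> \<Longrightarrow> \<tau> \<cdot> \<sigma> \<in> hom2 K L N"
    and vcomp_id_right: "\<sigma> \<in> hom2 K M N \<Longrightarrow> \<sigma> \<cdot> \<guillemotleft>M\<guillemotright> = \<sigma>"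
    and vcomp_id_left: "\<sigma> \<in> hom2 K M N \<Longrightarrow> \<guillemotleft>N\<guillemotright> \<cdot> \<sigma> = \<sigma>"
    and vcomp_assoc: "\<lbrakk>\<sigma> \<in> hom2 K L M; \<tau> \<in> hom2 K M N; \<upsilon> \<in> hom2 K N P\<rbrakk>
          \<Longrightarrow> (\<upsilon> \<cdot> \<tau>) \<cdot> \<sigma> = \<upsilon> \<cdot> (\<tau> \<cdot> \<sigma>)"
    and id1_hom: "a \<in> Obj K \<Longrightarrow> id1 K a \<in> hom1 K a a"
    and comp1_hom: "\<lbrakk>N \<in> hom1 K a b; M \<in> hom1 K b c\<rbrakk> \<Longrightarrow> M \<otimes> N \<in> hom1 K a c"
    and hcomp_hom: "\<lbrakk>\<sigma> \<in> hom2 K M M'; \<tau> \<in> hom2 K N N'; src K M = trg K N\<rbrakk>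
          \<Longrightarrow> \<sigma> \<star> \<tau> \<in> hom2 K (M \<otimes> N) (M' \<otimes> N')"
    and hcomp_id: "\<lbrakk>M \<in> Cell1 K; N \<in> Cell1 K; src K M = trg K N\<rbrakk>
          \<Longrightarrow> \<guillemotleft>M\<guillemotright> \<star> \<guillemotleft>N\<guillemotright> = \<guillemotleft>M \<otimes> N\<guillemotright>"
    and interchange: "\<lbrakk>\<sigma> \<in> hom2 K M M'; \<sigma>' \<in> hom2 K M' M''; \<tau> \<in> hom2 K N N'; \<tau>' \<in> hom2 K N' N'';
            src K M = trg K N\<rbrakk>
          \<Longrightarrow> (\<sigma>' \<cdot> \<sigma>) \<star> (\<tau>' \<cdot> \<tau>) = (\<sigma>' \<star> \<tau>') \<cdot> (\<sigma> \<star> \<tau>)"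
    and assoc_hom: "\<lbrakk>M \<in> Cell1 K; N \<in> Cell1 K; P \<in> Cell1 K; src K M = trg K N; src K N = trg K P\<rbrakk>
          \<Longrightarrow> assoc K M N P \<in> hom2 K ((M \<otimes> N) \<otimes> P) (M \<otimes> (N \<otimes> P))"
    and assoc_iso: "\<lbrakk>M \<in> Cell1 K; N \<in> Cell1 K; P \<in> Cell1 K; src K M = trg K N; src K N = trg K P\<rbrakk>
          \<Longrightarrow> iso2 K (assoc K M N P)"
    and assoc_natural: "\<lbrakk>\<sigma> \<in> hom2 K M M'; \<tau> \<in> hom2 K N N'; \<upsilon> \<in> hom2 K P P';
            src K M = trg K N; src K N = trg K P\<rbrakk>
          \<Longrightarrow> assoc K M' N' P' \<cdot> ((\<sigma> \<star> \<tau>) \<star> \<upsilon>) = (\<sigma> \<star> (\<tau> \<star> \<upsilon>)) \<cdot> assoc K M N P"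
    and lunit_hom: "M \<in> hom1 K a b \<Longrightarrow> lunit K M \<in> hom2 K (id1 K b \<otimes> M) M"
    and lunit_iso: "M \<in> Cell1 K \<Longrightarrow> iso2 K (lunit K M)"
    and lunit_natural: "\<lbrakk>\<sigma> \<in> hom2 K M M'; M \<in> hom1 K a b\<rbrakk>
          \<Longrightarrow> lunit K M' \<cdot> (\<guillemotleft>id1 K b\<guillemotright> \<star> \<sigma>) = \<sigma> \<cdot> lunit K M"
    and runit_hom: "M \<in> hom1 K a b \<Longrightarrow> runit K M \<in> hom2 K (M \<otimes> id1 K a) M"
    and runit_iso: "M \<in> Cell1 K \<Longrightarrow> iso2 K (runit K M)"
    and runit_natural: "\<lbrakk>\<sigma> \<in> hom2 K M M'; M \<in> hom1 K a b\<rbrakk>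
          \<Longrightarrow> runit K M' \<cdot> (\<sigma> \<star> \<guillemotleft>id1 K a\<guillemotright>) = \<sigma> \<cdot> runit K M"
    and pentagon: "\<lbrakk>M \<in> Cell1 K; N \<in> Cell1 K; P \<in> Cell1 K; Q \<in> Cell1 K;
            src K M = trg K N; src K N = trg K P; src K P = trg K Q\<rbrakk>
          \<Longrightarrow> assoc K M N (P \<otimes> Q) \<cdot> assoc K (M \<otimes> N) P Q =
              (\<guillemotleft>M\<guillemotright> \<star> assoc K N P Q) \<cdot> assoc K M (N \<otimes> P) Q \<cdot> (assoc K M N P \<star> \<guillemotleft>Q\<guillemotright>)"
    and triangle: "\<lbrakk>N \<in> hom1 K a b; M \<in> hom1 K b c\<rbrakk>
          \<Longrightarrow> (\<guillemotleft>M\<guillemotright> \<star> lunit K N) \<cdot> assoc K M (id1 K b) N = runit K M \<star> \<guillemotleft>N\<guillemotright>"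


section \<open>Monads\<close>

text \<open>
  Below, the coherence isomorphisms that are usually suppressed are inserted explicitly.
  A monad is presented by an object \<open>k\<close>, a 1-cell, a multiplication and a unit.
\<close>

definition is_monad ::
    "('o, 'm, 'c, 'x) bicat_scheme \<Rightarrow> 'o \<Rightarrow> 'm \<Rightarrow> 'c \<Rightarrow> 'c \<Rightarrow> bool" where
  "is_monad K k A \<mu> \<eta> \<longleftrightarrow>
     k \<in> Obj K \<and> A \<in> hom1 K k k \<and> \<mu> \<in> hom2 K (A \<otimes> A) A \<and> \<eta> \<in> hom2 K (id1 K k) A \<and>
     \<mu> \<cdot> (\<mu> \<star> \<guillemotleft>A\<guillemotright>) = \<mu> \<cdot> (\<guillemotleft>A\<guillemotright> \<star> \<mu>) \<cdot> assoc K A A A \<and>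
     \<mu> \<cdot> (\<eta> \<star> \<guillemotleft>A\<guillemotright>) = lunit K A \<and>
     \<mu> \<cdot> (\<guillemotleft>A\<guillemotright> \<star> \<eta>) = runit K A" for K (structure)

definition monad_hom ::
    "('o, 'm, 'c, 'x) bicat_scheme \<Rightarrow> 'm \<Rightarrow> 'c \<Rightarrow> 'c \<Rightarrow> 'm \<Rightarrow> 'c \<Rightarrow> 'c \<Rightarrow> 'c \<Rightarrow> bool" where
  "monad_hom K A \<mu>\<^sub>A \<eta>\<^sub>A R \<mu>\<^sub>R \<eta>\<^sub>R \<alpha> \<longleftrightarrow>
     \<alpha> \<in> hom2 K A R \<and> \<alpha> \<cdot> \<mu>\<^sub>A = \<mu>\<^sub>R \<cdot> (\<alpha> \<star> \<alpha>) \<and> \<alpha> \<cdot> \<eta>\<^sub>A = \<eta>\<^sub>R" for K (structure)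

definition isomorphic_monads ::
    "('o, 'm, 'c, 'x) bicat_scheme \<Rightarrow> 'o \<Rightarrow> 'm \<Rightarrow> 'c \<Rightarrow> 'c \<Rightarrow> 'm \<Rightarrow> 'c \<Rightarrow> 'c \<Rightarrow> bool" where
  "isomorphic_monads K k R \<mu>\<^sub>R \<eta>\<^sub>R S \<mu>\<^sub>S \<eta>\<^sub>S \<longleftrightarrow>
     is_monad K k R \<mu>\<^sub>R \<eta>\<^sub>R \<and> is_monad K k S \<mu>\<^sub>S \<eta>\<^sub>S \<and>
     (\<exists>\<phi>. monad_hom K R \<mu>\<^sub>R \<eta>\<^sub>R S \<mu>\<^sub>S \<eta>\<^sub>S \<phi> \<and> iso2 K \<phi>)"


section \<open>Weak distributive laws and weak wreath products\<close>

text \<open>The 2-cell \<open>(\<mu>\<^sub>B \<otimes> A)(B \<otimes> \<Psi>) : (B \<otimes> A) \<otimes> B \<rightarrow> B \<otimes> A\<close>.\<close>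

definition wdl_left ::
    "('o, 'm, 'c, 'x) bicat_scheme \<Rightarrow> 'm \<Rightarrow> 'm \<Rightarrow> 'c \<Rightarrow> 'c \<Rightarrow> 'c" where
  "wdl_left K A B \<mu>\<^sub>B \<Psi> =
     (\<mu>\<^sub>B \<star> \<guillemotleft>A\<guillemotright>) \<cdot> assoc_inv K B B A \<cdot> (\<guillemotleft>B\<guillemotright> \<star> \<Psi>) \<cdot> assoc K B A B" for K (structure)

text \<open>The 2-cell \<open>(B \<otimes> \<mu>\<^sub>A)(\<Psi> \<otimes> A) : A \<otimes> (B \<otimes> A) \<rightarrow> B \<otimes> A\<close>.\<close>

definition wdl_right ::
    "('o, 'm, 'c, 'x) bicat_scheme \<Rightarrow> 'm \<Rightarrow> 'c \<Rightarrow> 'm \<Rightarrow> 'c \<Rightarrow> 'c" where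
  "wdl_right K A \<mu>\<^sub>A B \<Psi> =
     (\<guillemotleft>B\<guillemotright> \<star> \<mu>\<^sub>A) \<cdot> assoc K B A A \<cdot> (\<Psi> \<star> \<guillemotleft>A\<guillemotright>) \<cdot> assoc_inv K A B A" for K (structure)

definition weak_distributive_law ::
    "('o, 'm, 'c, 'x) bicat_scheme \<Rightarrow> 'o \<Rightarrow> 'm \<Rightarrow> 'c \<Rightarrow> 'c \<Rightarrow> 'm \<Rightarrow> 'c \<Rightarrow> 'c \<Rightarrow> 'c \<Rightarrow> bool" where
  "weak_distributive_law K k A \<mu>\<^sub>A \<eta>\<^sub>A B \<mu>\<^sub>B \<eta>\<^sub>B \<Psi> \<longleftrightarrow>
     is_monad K k A \<mu>\<^sub>A \<eta>\<^sub>A \<and> is_monad K k B \<mu>\<^sub>B \<eta>\<^sub>B \<and>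
     \<Psi> \<in> hom2 K (A \<otimes> B) (B \<otimes> A) \<and>
     \<Psi> \<cdot> (\<mu>\<^sub>A \<star> \<guillemotleft>B\<guillemotright>) = wdl_right K A \<mu>\<^sub>A B \<Psi> \<cdot> (\<guillemotleft>A\<guillemotright> \<star> \<Psi>) \<cdot> assoc K A A B \<and>
     \<Psi> \<cdot> (\<guillemotleft>A\<guillemotright> \<star> \<mu>\<^sub>B) = wdl_left K A B \<mu>\<^sub>B \<Psi> \<cdot> (\<Psi> \<star> \<guillemotleft>B\<guillemotright>) \<cdot> assoc_inv K A B B \<and>
     wdl_left K A B \<mu>\<^sub>B \<Psi> \<cdot> (\<guillemotleft>B \<otimes> A\<guillemotright> \<star> \<eta>\<^sub>B) \<cdot> runit_inv K (B \<otimes> A) =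
     wdl_right K A \<mu>\<^sub>A B \<Psi> \<cdot> (\<eta>\<^sub>A \<star> \<guillemotleft>B \<otimes> A\<guillemotright>) \<cdot> lunit_inv K (B \<otimes> A)" for K (structure)

text \<open>The (possibly non-unital) multiplication \<open>(\<mu>\<^sub>B \<otimes> \<mu>\<^sub>A)(B \<otimes> \<Psi> \<otimes> A)\<close> on \<open>B \<otimes> A\<close>.\<close>

definition wreath_mult ::
    "('o, 'm, 'c, 'x) bicat_scheme \<Rightarrow> 'm \<Rightarrow> 'c \<Rightarrow> 'm \<Rightarrow> 'c \<Rightarrow> 'c \<Rightarrow> 'c" where
  "wreath_mult K A \<mu>\<^sub>A B \<mu>\<^sub>B \<Psi> =
     (\<mu>\<^sub>B \<star> \<mu>\<^sub>A) \<cdot> assoc_inv K B B (A \<otimes> A) \<cdot>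
     (\<guillemotleft>B\<guillemotright> \<star> (assoc K B A A \<cdot> (\<Psi> \<star> \<guillemotleft>A\<guillemotright>) \<cdot> assoc_inv K A B A)) \<cdot>
     assoc K B A (B \<otimes> A)" for K (structure)

text \<open>The idempotent \<open>\<mu>(B \<otimes> \<eta>\<^sub>A \<otimes> \<eta>\<^sub>B \<otimes> A)\<close> on \<open>B \<otimes> A\<close>.\<close>

definition wreath_idem ::
    "('o, 'm, 'c, 'x) bicat_scheme \<Rightarrow> 'm \<Rightarrow> 'c \<Rightarrow> 'c \<Rightarrow> 'm \<Rightarrow> 'c \<Rightarrow> 'c \<Rightarrow> 'c \<Rightarrow> 'c" where
  "wreath_idem K A \<mu>\<^sub>A \<eta>\<^sub>A B \<mu>\<^sub>B \<eta>\<^sub>B \<Psi> =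
     wreath_mult K A \<mu>\<^sub>A B \<mu>\<^sub>B \<Psi> \<cdot>
     ((\<guillemotleft>B\<guillemotright> \<star> \<eta>\<^sub>A) \<star> (\<eta>\<^sub>B \<star> \<guillemotleft>A\<guillemotright>)) \<cdot> (runit_inv K B \<star> lunit_inv K A)" for K (structure)

definition is_splitting ::
    "('o, 'm, 'c, 'x) bicat_scheme \<Rightarrow> 'm \<Rightarrow> 'c \<Rightarrow> 'm \<Rightarrow> 'c \<Rightarrow> 'c \<Rightarrow> bool" where
  "is_splitting K M e P \<pi> \<iota> \<longleftrightarrow>
     \<pi> \<in> hom2 K M P \<and> \<iota> \<in> hom2 K P M \<and> \<pi> \<cdot> \<iota> = \<guillemotleft>P\<guillemotright> \<and> \<iota> \<cdot> \<pi> = e" for K (structure)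

definition splits :: "('o, 'm, 'c, 'x) bicat_scheme \<Rightarrow> 'm \<Rightarrow> 'c \<Rightarrow> bool" where
  "splits K M e \<longleftrightarrow> (\<exists>P \<pi> \<iota>. is_splitting K M e P \<pi> \<iota>)"

definition weak_wreath_mult ::
    "('o, 'm, 'c, 'x) bicat_scheme \<Rightarrow> 'm \<Rightarrow> 'c \<Rightarrow> 'm \<Rightarrow> 'c \<Rightarrow> 'c \<Rightarrow> 'c \<Rightarrow> 'c \<Rightarrow> 'c" where
  "weak_wreath_mult K A \<mu>\<^sub>A B \<mu>\<^sub>B \<Psi> \<pi> \<iota> =
     \<pi> \<cdot> wreath_mult K A \<mu>\<^sub>A B \<mu>\<^sub>B \<Psi> \<cdot> (\<iota> \<star> \<iota>)" for K (structure)

definition weak_wreath_unit ::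
    "('o, 'm, 'c, 'x) bicat_scheme \<Rightarrow> 'o \<Rightarrow> 'c \<Rightarrow> 'c \<Rightarrow> 'c \<Rightarrow> 'c" where
  "weak_wreath_unit K k \<eta>\<^sub>A \<eta>\<^sub>B \<pi> =
     \<pi> \<cdot> (\<eta>\<^sub>B \<star> \<eta>\<^sub>A) \<cdot> lunit_inv K (id1 K k)" for K (structure)


section \<open>Bilinear factorization structures\<close>

text \<open>
  The bimodules are given by left \<open>B\<close>-actions \<open>l\<^sub>M\<close>, \<open>l\<^sub>N\<close> and right \<open>A\<close>-actions \<open>r\<^sub>M\<close>, \<open>r\<^sub>N\<close>.
  The bimodule axioms are not part of the predicate; for the actions used below they
  follow from the monad and monad morphism axioms.
\<close>

definition bimodule_hom ::
    "('o, 'm, 'c, 'x) bicat_scheme \<Rightarrow> 'm \<Rightarrow> 'm \<Rightarrow>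
     'm \<Rightarrow> 'c \<Rightarrow> 'c \<Rightarrow> 'm \<Rightarrow> 'c \<Rightarrow> 'c \<Rightarrow> 'c \<Rightarrow> bool" where
  "bimodule_hom K B A M l\<^sub>M r\<^sub>M N l\<^sub>N r\<^sub>N f \<longleftrightarrow>
     f \<in> hom2 K M N \<and>
     f \<cdot> l\<^sub>M = l\<^sub>N \<cdot> (\<guillemotleft>B\<guillemotright> \<star> f) \<and>
     f \<cdot> r\<^sub>M = r\<^sub>N \<cdot> (f \<star> \<guillemotleft>A\<guillemotright>)" for K (structure)

definition bilinear_factorization_structure ::
    "('o, 'm, 'c, 'x) bicat_scheme \<Rightarrow> 'o \<Rightarrow> 'm \<Rightarrow> 'c \<Rightarrow> 'c \<Rightarrow> 'm \<Rightarrow> 'c \<Rightarrow> 'c \<Rightarrow> 'm \<Rightarrow> 'c \<Rightarrow> 'c \<Rightarrow>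
     'c \<Rightarrow> 'c \<Rightarrow> 'c \<Rightarrow> bool" where
  "bilinear_factorization_structure K k A \<mu>\<^sub>A \<eta>\<^sub>A B \<mu>\<^sub>B \<eta>\<^sub>B R \<mu>\<^sub>R \<eta>\<^sub>R \<alpha> \<beta> \<iota> \<longleftrightarrow>
     is_monad K k A \<mu>\<^sub>A \<eta>\<^sub>A \<and> is_monad K k B \<mu>\<^sub>B \<eta>\<^sub>B \<and> is_monad K k R \<mu>\<^sub>R \<eta>\<^sub>R \<and>
     monad_hom K A \<mu>\<^sub>A \<eta>\<^sub>A R \<mu>\<^sub>R \<eta>\<^sub>R \<alpha> \<and>
     monad_hom K B \<mu>\<^sub>B \<eta>\<^sub>B R \<mu>\<^sub>R \<eta>\<^sub>R \<beta> \<and>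
     bimodule_hom K B A
       R (\<mu>\<^sub>R \<cdot> (\<beta> \<star> \<guillemotleft>R\<guillemotright>)) (\<mu>\<^sub>R \<cdot> (\<guillemotleft>R\<guillemotright> \<star> \<alpha>))
       (B \<otimes> A) ((\<mu>\<^sub>B \<star> \<guillemotleft>A\<guillemotright>) \<cdot> assoc_inv K B B A) ((\<guillemotleft>B\<guillemotright> \<star> \<mu>\<^sub>A) \<cdot> assoc K B A A)
       \<iota> \<and>
     (\<mu>\<^sub>R \<cdot> (\<beta> \<star> \<alpha>)) \<cdot> \<iota> = \<guillemotleft>R\<guillemotright>" for K (structure)

end

theory Submission
  imports Defs
begin

text \<open>
  For 2-cells \<open>x : X \<rightarrow> R\<close> and \<open>y : Y \<rightarrow> R\<close> into a monad, write \<open>x \<bullet> y\<close> for the product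
  \<open>\<mu>\<^sub>R \<cdot> (x \<star> y) : X \<otimes> Y \<rightarrow> R\<close>. The monad axioms say exactly that this product of ``generalized
  elements'' is associative and unital up to precomposition with an associator or a unitor.
  These three laws (\<open>convolution_assoc\<close>, \<open>convolution_unit_left\<close>, \<open>convolution_unit_right\<close>) control
  the coherence cells, so that one can calculate with products almost as in an ordinary monoid.

  In this notation \<open>\<pi> = \<beta> \<bullet> \<alpha>\<close> and \<open>\<Psi> = \<iota> \<cdot> (\<alpha> \<bullet> \<beta>)\<close>. Bilinearity of \<open>\<iota>\<close> means that acting by
  \<open>B\<close> from the left or by \<open>A\<close> from the right on \<open>\<iota> \<cdot> x\<close> gives \<open>\<iota> \<cdot> (\<beta> \<bullet> x)\<close> or
  \<open>\<iota> \<cdot> (x \<bullet> \<alpha>)\<close>. As every composite in the definitions of weak distributive law and weak wreath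
  product is \<open>\<Psi>\<close> followed by such actions, each one is \<open>\<iota>\<close> applied to a product in \<open>R\<close>:
  \<^item> \<open>(\<mu>\<^sub>B \<otimes> A)(B \<otimes> \<Psi>) = \<iota> \<cdot> (\<pi> \<bullet> \<beta>)\<close> and \<open>(B \<otimes> \<mu>\<^sub>A)(\<Psi> \<otimes> A) = \<iota> \<cdot> (\<alpha> \<bullet> \<pi>)\<close>
    (\<open>wdl_left_eq\<close>, \<open>wdl_right_eq\<close>);
  \<^item> the multiplication on \<open>B \<otimes> A\<close> is \<open>\<iota> \<cdot> (\<pi> \<bullet> \<pi>)\<close> (\<open>wreath_mult_eq\<close>);
  \<^item> the idempotent is \<open>\<iota> \<cdot> \<pi>\<close> (\<open>wreath_idem_eq\<close>).

  Now \<open>\<pi> \<cdot> \<iota> = R\<close> cancels the inner occurrences of \<open>\<iota>\<close>. Hence both sides of the first two axioms of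
  a weak distributive law are \<open>\<iota>\<close> applied to the two bracketings of a triple product, both sides of the
  third are \<open>\<iota> \<cdot> \<pi>\<close>, and the idempotent is split by \<open>R\<close> itself. Any other splitting
  \<open>(P, p, i)\<close> is related to this one by the isomorphism \<open>p \<cdot> \<iota> : R \<rightarrow> P\<close> with inverse \<open>\<pi> \<cdot> i\<close>, and the
  weak wreath product structure on \<open>P\<close> is the structure of \<open>R\<close> transported along it.
\<close>

section \<open>Calculus of cells in a bicategory\<close>

text \<open>
  The axioms speak of \<open>hom2 K M N\<close>, where \<open>M\<close> and \<open>N\<close> would be undetermined variables in the
  premises of a rewrite rule. The rules below speak of \<open>dom2\<close>, \<open>cod2\<close>, \<open>src\<close> and \<open>trg\<close> instead, so
  that the simplifier decides composability by computing boundaries.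
\<close>

context bicategory
begin

lemma hom2D:
  assumes "\<sigma> \<in> hom2 K M N"
  shows "\<sigma> \<in> Cell2 K" "dom2 K \<sigma> = M" "cod2 K \<sigma> = N" "M \<in> Cell1 K" "N \<in> Cell1 K"
    "src K N = src K M" "trg K N = trg K M"
  using assms dom2_Cell1 cod2_Cell1 src_parallel trg_parallel unfolding hom2_def by auto

lemma hom2I: "\<sigma> \<in> Cell2 K \<Longrightarrow> dom2 K \<sigma> = M \<Longrightarrow> cod2 K \<sigma> = N \<Longrightarrow> \<sigma> \<in> hom2 K M N"
  by (simp add: hom2_def)

lemma comp1_simps [simp]:
  assumes "M \<in> Cell1 K" "N \<in> Cell1 K" "src K M = trg K N"
  shows "M \<otimes> N \<in> Cell1 K" "src K (M \<otimes> N) = src K N" "trg K (M \<otimes> N) = trg K M"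
  using comp1_hom[of N "src K N" "src K M" M "trg K M"] assms by (auto simp: hom1_def)

lemma id1_simps [simp]:
  assumes "a \<in> Obj K"
  shows "id1 K a \<in> Cell1 K" "src K (id1 K a) = a" "trg K (id1 K a) = a"
  using id1_hom[OF assms] by (auto simp: hom1_def)

lemma id2_simps [simp]:
  assumes "M \<in> Cell1 K"
  shows "\<guillemotleft>M\<guillemotright> \<in> Cell2 K" "dom2 K \<guillemotleft>M\<guillemotright> = M" "cod2 K \<guillemotleft>M\<guillemotright> = M"
  using id2_hom[OF assms] by (auto dest: hom2D)

lemma vcomp_simps [simp]:
  assumes "\<sigma> \<in> Cell2 K" "\<tau> \<in> Cell2 K" "dom2 K \<tau> = cod2 K \<sigma>"
  shows "\<tau> \<cdot> \<sigma> \<in> Cell2 K" "dom2 K (\<tau> \<cdot> \<sigma>) = dom2 K \<sigma>" "cod2 K (\<tau> \<cdot> \<sigma>) = cod2 K \<tau>"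
  using vcomp_hom[OF hom2I[OF assms(1) refl refl] hom2I[OF assms(2,3) refl]] by (auto dest: hom2D)

lemma hcomp_simps [simp]:
  assumes "\<sigma> \<in> Cell2 K" "\<tau> \<in> Cell2 K" "src K (dom2 K \<sigma>) = trg K (dom2 K \<tau>)"
  shows "\<sigma> \<star> \<tau> \<in> Cell2 K" "dom2 K (\<sigma> \<star> \<tau>) = dom2 K \<sigma> \<otimes> dom2 K \<tau>"
    "cod2 K (\<sigma> \<star> \<tau>) = cod2 K \<sigma> \<otimes> cod2 K \<tau>"
  using hcomp_hom[OF hom2I[OF assms(1) refl refl] hom2I[OF assms(2) refl refl] assms(3)]
  by (auto dest: hom2D)

lemma vcomp_unit [simp]:
  "\<sigma> \<in> Cell2 K \<Longrightarrow> dom2 K \<sigma> = M \<Longrightarrow> \<sigma> \<cdot> \<guillemotleft>M\<guillemotright> = \<sigma>"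
  "\<sigma> \<in> Cell2 K \<Longrightarrow> cod2 K \<sigma> = M \<Longrightarrow> \<guillemotleft>M\<guillemotright> \<cdot> \<sigma> = \<sigma>"
  using vcomp_id_right[of \<sigma>] vcomp_id_left[of \<sigma>] by (simp_all add: hom2_def)

lemma vcomp_assoc_cells [simp]:
  assumes "\<sigma> \<in> Cell2 K" "\<tau> \<in> Cell2 K" "\<upsilon> \<in> Cell2 K"
    "dom2 K \<tau> = cod2 K \<sigma>" "dom2 K \<upsilon> = cod2 K \<tau>"
  shows "(\<upsilon> \<cdot> \<tau>) \<cdot> \<sigma> = \<upsilon> \<cdot> \<tau> \<cdot> \<sigma>"
  using vcomp_assoc assms by (auto simp: hom2_def)

lemma interchange_cells:
  assumes "\<sigma> \<in> Cell2 K" "\<sigma>' \<in> Cell2 K" "\<tau> \<in> Cell2 K" "\<tau>' \<in> Cell2 K"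
    "dom2 K \<sigma>' = cod2 K \<sigma>" "dom2 K \<tau>' = cod2 K \<tau>" "src K (dom2 K \<sigma>) = trg K (dom2 K \<tau>)"
  shows "(\<sigma>' \<star> \<tau>') \<cdot> (\<sigma> \<star> \<tau>) = (\<sigma>' \<cdot> \<sigma>) \<star> (\<tau>' \<cdot> \<tau>)"
  using interchange assms by (auto simp: hom2_def)

lemma inverse2_unique:
  assumes "\<sigma> \<in> Cell2 K" "inverse2 K \<sigma> \<tau>" "inverse2 K \<sigma> \<tau>'"
  shows "\<tau> = \<tau>'"
proof -
  note \<tau> = assms(2,3)[unfolded inverse2_def hom2_def]
  have "\<tau> = \<tau> \<cdot> (\<sigma> \<cdot> \<tau>')"
    using \<tau> by simp
  also have "\<dots> = (\<tau> \<cdot> \<sigma>) \<cdot> \<tau>'"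
    using \<tau> assms(1) by (subst vcomp_assoc_cells) auto
  also have "\<dots> = \<tau>'"
    using \<tau> by simp
  finally show ?thesis .
qed

lemma inverse2_inv2:
  assumes "iso2 K \<sigma>"
  shows "inverse2 K \<sigma> (inv2 K \<sigma>)"
  using assms inverse2_unique unfolding iso2_def inv2_def by (metis (no_types, lifting) theI)

lemma inv2_simps [simp]:
  assumes "iso2 K \<sigma>"
  shows "inv2 K \<sigma> \<in> Cell2 K" "dom2 K (inv2 K \<sigma>) = cod2 K \<sigma>" "cod2 K (inv2 K \<sigma>) = dom2 K \<sigma>"
    "inv2 K \<sigma> \<cdot> \<sigma> = \<guillemotleft>dom2 K \<sigma>\<guillemotright>" "\<sigma> \<cdot> inv2 K \<sigma> = \<guillemotleft>cod2 K \<sigma>\<guillemotright>"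
  using inverse2_inv2[OF assms] by (auto simp: inverse2_def hom2_def)

lemma assoc_simps [simp]:
  assumes "M \<in> Cell1 K" "N \<in> Cell1 K" "P \<in> Cell1 K" "src K M = trg K N" "src K N = trg K P"
  shows "assoc K M N P \<in> Cell2 K" "dom2 K (assoc K M N P) = (M \<otimes> N) \<otimes> P"
    "cod2 K (assoc K M N P) = M \<otimes> (N \<otimes> P)" "iso2 K (assoc K M N P)"
  using assoc_hom[OF assms] assoc_iso[OF assms] by (auto simp: hom2_def)

lemma lunit_simps [simp]:
  assumes "M \<in> Cell1 K"
  shows "lunit K M \<in> Cell2 K" "dom2 K (lunit K M) = id1 K (trg K M) \<otimes> M"
    "cod2 K (lunit K M) = M" "iso2 K (lunit K M)"
  using lunit_hom[of M "src K M" "trg K M"] lunit_iso[OF assms] assms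
  by (auto simp: hom2_def hom1_def)

lemma runit_simps [simp]:
  assumes "M \<in> Cell1 K"
  shows "runit K M \<in> Cell2 K" "dom2 K (runit K M) = M \<otimes> id1 K (src K M)"
    "cod2 K (runit K M) = M" "iso2 K (runit K M)"
  using runit_hom[of M "src K M" "trg K M"] runit_iso[OF assms] assms
  by (auto simp: hom2_def hom1_def)

lemma vcomp_inv2_cancel:
  assumes "iso2 K \<sigma>" "\<tau> \<in> Cell2 K" "dom2 K \<tau> = cod2 K \<sigma>"
  shows "(\<tau> \<cdot> \<sigma>) \<cdot> inv2 K \<sigma> = \<tau>"
  using assms by (subst vcomp_assoc_cells) (auto simp: iso2_def)

lemma assoc_inv_natural:
  assumes "\<sigma> \<in> hom2 K M M'" "\<tau> \<in> hom2 K N N'" "\<upsilon> \<in> hom2 K P P'"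
    "src K M = trg K N" "src K N = trg K P"
  shows "assoc_inv K M' N' P' \<cdot> (\<sigma> \<star> (\<tau> \<star> \<upsilon>)) = ((\<sigma> \<star> \<tau>) \<star> \<upsilon>) \<cdot> assoc_inv K M N P"
proof -
  note [simp] = hom2D[OF assms(1)] hom2D[OF assms(2)] hom2D[OF assms(3)] assms(4,5)
  let ?a = "assoc K M N P" and ?a' = "assoc K M' N' P'"
  have "inv2 K ?a' \<cdot> (\<sigma> \<star> (\<tau> \<star> \<upsilon>)) = inv2 K ?a' \<cdot> ((\<sigma> \<star> (\<tau> \<star> \<upsilon>)) \<cdot> ?a) \<cdot> inv2 K ?a"
    by simp
  also have "\<dots> = inv2 K ?a' \<cdot> (?a' \<cdot> ((\<sigma> \<star> \<tau>) \<star> \<upsilon>)) \<cdot> inv2 K ?a"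
    by (simp only: assoc_natural[OF assms])
  also have "\<dots> = (inv2 K ?a' \<cdot> ?a') \<cdot> ((\<sigma> \<star> \<tau>) \<star> \<upsilon>) \<cdot> inv2 K ?a"
    by (simp del: inv2_simps(4))
  also have "\<dots> = ((\<sigma> \<star> \<tau>) \<star> \<upsilon>) \<cdot> inv2 K ?a"
    by simp
  finally show ?thesis .
qed

end

section \<open>Products of 2-cells into a monad\<close>

locale bicategory_monad = bicategory K for K :: "('o, 'm, 'c, 'x) bicat_scheme" (structure) +
  fixes k :: 'o and R :: 'm and \<mu> \<eta> :: 'c
  assumes monad: "is_monad K k R \<mu> \<eta>"
begin

abbreviation convolution (infix "\<bullet>" 75) where
  "x \<bullet> y \<equiv> \<mu> \<cdot> (x \<star> y)"

lemma monad_simps [simp]: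
  "k \<in> Obj K" "R \<in> Cell1 K" "src K R = k" "trg K R = k"
  "\<mu> \<in> Cell2 K" "dom2 K \<mu> = R \<otimes> R" "cod2 K \<mu> = R"
  "\<eta> \<in> Cell2 K" "dom2 K \<eta> = id1 K k" "cod2 K \<eta> = R"
  using monad by (auto simp: is_monad_def hom1_def hom2_def)

lemma hom2_R:
  assumes "x \<in> hom2 K X R"
  shows "x \<in> Cell2 K" "dom2 K x = X" "cod2 K x = R" "X \<in> Cell1 K" "src K X = k" "trg K X = k"
  using hom2D[OF assms] by auto

lemma convolution_hom:
  assumes "x \<in> hom2 K X R" "y \<in> hom2 K Y R"
  shows "x \<bullet> y \<in> hom2 K (X \<otimes> Y) R"
  using hom2_R[OF assms(1)] hom2_R[OF assms(2)] by (auto intro: hom2I)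

text \<open>This is interchange; it moves 2-cells between the factors of a product and its domain.\<close>

lemma convolution_precomp:
  assumes "x \<in> hom2 K X R" "y \<in> hom2 K Y R" "f \<in> hom2 K X' X" "g \<in> hom2 K Y' Y"
  shows "(x \<bullet> y) \<cdot> (f \<star> g) = (x \<cdot> f) \<bullet> (y \<cdot> g)"
  using hom2_R[OF assms(1)] hom2_R[OF assms(2)] hom2D[OF assms(3)] hom2D[OF assms(4)]
  by (simp add: interchange_cells)

text \<open>
  Associativity of \<open>\<mu>\<close> lives on \<open>R \<otimes> R \<otimes> R\<close>; naturality of the associator carries it to the domains
  of \<open>x\<close>, \<open>y\<close> and \<open>z\<close>.
\<close>

lemma convolution_assoc:
  assumes "x \<in> hom2 K X R" "y \<in> hom2 K Y R" "z \<in> hom2 K Z R"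
  shows "(x \<bullet> y) \<bullet> z = (x \<bullet> (y \<bullet> z)) \<cdot> assoc K X Y Z"
proof -
  note [simp] = hom2_R[OF assms(1)] hom2_R[OF assms(2)] hom2_R[OF assms(3)]
  have "(x \<bullet> y) \<bullet> z = \<mu> \<cdot> (\<mu> \<star> \<guillemotleft>R\<guillemotright>) \<cdot> ((x \<star> y) \<star> z)"
    by (simp add: interchange_cells)
  also have "\<dots> = (\<mu> \<cdot> (\<mu> \<star> \<guillemotleft>R\<guillemotright>)) \<cdot> ((x \<star> y) \<star> z)"
    by simp
  also have "\<dots> = (\<mu> \<cdot> (\<guillemotleft>R\<guillemotright> \<star> \<mu>) \<cdot> assoc K R R R) \<cdot> ((x \<star> y) \<star> z)"
    using monad by (simp only: is_monad_def)
  also have "\<dots> = \<mu> \<cdot> (\<guillemotleft>R\<guillemotright> \<star> \<mu>) \<cdot> (assoc K R R R \<cdot> ((x \<star> y) \<star> z))"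
    by simp
  also have "\<dots> = \<mu> \<cdot> (\<guillemotleft>R\<guillemotright> \<star> \<mu>) \<cdot> ((x \<star> (y \<star> z)) \<cdot> assoc K X Y Z)"
    by (subst assoc_natural[OF assms]) simp_all
  also have "\<dots> = (\<mu> \<cdot> ((\<guillemotleft>R\<guillemotright> \<star> \<mu>) \<cdot> (x \<star> (y \<star> z)))) \<cdot> assoc K X Y Z"
    by simp
  also have "\<dots> = (x \<bullet> (y \<bullet> z)) \<cdot> assoc K X Y Z"
    by (subst interchange_cells) simp_all
  finally show ?thesis .
qed

lemma convolution_assoc_inv:
  assumes "x \<in> hom2 K X R" "y \<in> hom2 K Y R" "z \<in> hom2 K Z R"
  shows "((x \<bullet> y) \<bullet> z) \<cdot> assoc_inv K X Y Z = x \<bullet> (y \<bullet> z)"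
  unfolding convolution_assoc[OF assms]
  using hom2_R[OF assms(1)] hom2_R[OF assms(2)] hom2_R[OF assms(3)]
  by (intro vcomp_inv2_cancel) simp_all

lemma convolution_unit_left:
  assumes "x \<in> hom2 K X R"
  shows "\<eta> \<bullet> x = x \<cdot> lunit K X"
proof -
  note [simp] = hom2_R[OF assms]
  have "\<eta> \<bullet> x = (\<mu> \<cdot> (\<eta> \<star> \<guillemotleft>R\<guillemotright>)) \<cdot> (\<guillemotleft>id1 K k\<guillemotright> \<star> x)"
    by (simp add: interchange_cells)
  also have "\<dots> = lunit K R \<cdot> (\<guillemotleft>id1 K k\<guillemotright> \<star> x)"
    using monad by (simp only: is_monad_def)
  also have "\<dots> = x \<cdot> lunit K X"
    using lunit_natural[OF assms] by (simp add: hom1_def)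
  finally show ?thesis .
qed

lemma convolution_unit_right:
  assumes "x \<in> hom2 K X R"
  shows "x \<bullet> \<eta> = x \<cdot> runit K X"
proof -
  note [simp] = hom2_R[OF assms]
  have "x \<bullet> \<eta> = (\<mu> \<cdot> (\<guillemotleft>R\<guillemotright> \<star> \<eta>)) \<cdot> (x \<star> \<guillemotleft>id1 K k\<guillemotright>)"
    by (simp add: interchange_cells)
  also have "\<dots> = runit K R \<cdot> (x \<star> \<guillemotleft>id1 K k\<guillemotright>)"
    using monad by (simp only: is_monad_def)
  also have "\<dots> = x \<cdot> runit K X"
    using runit_natural[OF assms] by (simp add: hom1_def)
  finally show ?thesis .
qed

lemma id_hom: "\<guillemotleft>R\<guillemotright> \<in> hom2 K R R"
  by (simp add: id2_hom)

lemma unit_hom: "\<eta> \<in> hom2 K (id1 K k) R"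
  by (simp add: hom2I)

text \<open>
  A monad structure transports along an isomorphism of 1-cells. The transported axioms are the laws of
  the product evaluated at \<open>\<psi>\<close>: once \<open>\<psi>\<close> is moved inside the product, it cancels each \<open>\<phi>\<close> occurring
  in the new multiplication and unit.
\<close>

lemma isomorphic_monads_transport:
  assumes \<phi>: "\<phi> \<in> hom2 K R P" and \<psi>: "\<psi> \<in> hom2 K P R"
    and inv: "\<psi> \<cdot> \<phi> = \<guillemotleft>R\<guillemotright>" "\<phi> \<cdot> \<psi> = \<guillemotleft>P\<guillemotright>"
  shows "isomorphic_monads K k R \<mu> \<eta> P (\<phi> \<cdot> (\<psi> \<bullet> \<psi>)) (\<phi> \<cdot> \<eta>)"
proof -
  note [simp] = hom2D(1-3)[OF \<phi>] hom2_R[OF \<psi>]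
  let ?m = "\<phi> \<cdot> (\<psi> \<bullet> \<psi>)" and ?e = "\<phi> \<cdot> \<eta>"
  have m: "?m \<cdot> (f \<star> g) = \<phi> \<cdot> ((\<psi> \<cdot> f) \<bullet> (\<psi> \<cdot> g))"
    if f: "f \<in> hom2 K X P" and g: "g \<in> hom2 K Y P" for f g X Y
  proof -
    have "(\<psi> \<bullet> \<psi>) \<cdot> (f \<star> g) = (\<psi> \<cdot> f) \<bullet> (\<psi> \<cdot> g)"
      by (rule convolution_precomp[OF \<psi> \<psi> f g])
    then show ?thesis
      using hom2D[OF f] hom2D[OF g] by simp
  qed
  have cancel: "\<psi> \<cdot> \<phi> \<cdot> x = x" if "x \<in> hom2 K X R" for x X
    using hom2_R[OF that] inv(1) vcomp_assoc[OF that \<phi> \<psi>] by simp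
  have m_hom: "?m \<in> hom2 K (P \<otimes> P) P" and e_hom: "?e \<in> hom2 K (id1 K k) P"
    and P_hom: "\<guillemotleft>P\<guillemotright> \<in> hom2 K P P"
    by (auto intro!: hom2I)
  have \<psi>\<psi>: "\<psi> \<bullet> \<psi> \<in> hom2 K (P \<otimes> P) R"
    by (rule convolution_hom[OF \<psi> \<psi>])
  have "?m \<cdot> (?m \<star> \<guillemotleft>P\<guillemotright>) = \<phi> \<cdot> ((\<psi> \<bullet> \<psi>) \<bullet> \<psi>)"
    by (simp only: m[OF m_hom P_hom] cancel[OF \<psi>\<psi>]) simp
  also have "\<dots> = \<phi> \<cdot> ((\<psi> \<bullet> (\<psi> \<bullet> \<psi>)) \<cdot> assoc K P P P)"
    by (simp only: convolution_assoc[OF \<psi> \<psi> \<psi>])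
  also have "\<dots> = (\<phi> \<cdot> (\<psi> \<bullet> (\<psi> \<bullet> \<psi>))) \<cdot> assoc K P P P"
    by simp
  also have "\<phi> \<cdot> (\<psi> \<bullet> (\<psi> \<bullet> \<psi>)) = ?m \<cdot> (\<guillemotleft>P\<guillemotright> \<star> ?m)"
    by (simp only: m[OF P_hom m_hom] cancel[OF \<psi>\<psi>]) simp
  also have "(?m \<cdot> (\<guillemotleft>P\<guillemotright> \<star> ?m)) \<cdot> assoc K P P P = ?m \<cdot> (\<guillemotleft>P\<guillemotright> \<star> ?m) \<cdot> assoc K P P P"
    by simp
  finally have associative: "?m \<cdot> (?m \<star> \<guillemotleft>P\<guillemotright>) = ?m \<cdot> (\<guillemotleft>P\<guillemotright> \<star> ?m) \<cdot> assoc K P P P" .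
  have "?m \<cdot> (?e \<star> \<guillemotleft>P\<guillemotright>) = \<phi> \<cdot> (\<eta> \<bullet> \<psi>)"
    by (simp only: m[OF e_hom P_hom] cancel[OF unit_hom]) simp
  also have "\<dots> = (\<phi> \<cdot> \<psi>) \<cdot> lunit K P"
    by (simp add: convolution_unit_left[OF \<psi>])
  finally have unit_left: "?m \<cdot> (?e \<star> \<guillemotleft>P\<guillemotright>) = lunit K P"
    by (simp only: inv) simp
  have "?m \<cdot> (\<guillemotleft>P\<guillemotright> \<star> ?e) = \<phi> \<cdot> (\<psi> \<bullet> \<eta>)"
    by (simp only: m[OF P_hom e_hom] cancel[OF unit_hom]) simp
  also have "\<dots> = (\<phi> \<cdot> \<psi>) \<cdot> runit K P"
    by (simp add: convolution_unit_right[OF \<psi>])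
  finally have unit_right: "?m \<cdot> (\<guillemotleft>P\<guillemotright> \<star> ?e) = runit K P"
    by (simp only: inv) simp
  have "is_monad K k P ?m ?e"
    using associative unit_left unit_right m_hom e_hom by (simp add: is_monad_def hom1_def)
  moreover have "\<phi> \<cdot> \<mu> = ?m \<cdot> (\<phi> \<star> \<phi>)"
    by (simp only: m[OF \<phi> \<phi>] inv) (simp add: hcomp_id)
  then have "monad_hom K R \<mu> \<eta> P ?m ?e \<phi>"
    using \<phi> by (simp add: monad_hom_def)
  moreover have "iso2 K \<phi>"
    using \<psi> inv unfolding iso2_def inverse2_def by auto
  ultimately show ?thesis
    using monad unfolding isomorphic_monads_def by blast
qed

end

section \<open>The weak distributive law of a bilinear factorization\<close>

locale bilinear_factorization = bicategory K
  for K :: "('o, 'm, 'c, 'x) bicat_scheme" (structure) +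
  fixes k :: 'o and A :: 'm and \<mu>\<^sub>A \<eta>\<^sub>A :: 'c and B :: 'm and \<mu>\<^sub>B \<eta>\<^sub>B :: 'c
    and R :: 'm and \<mu>\<^sub>R \<eta>\<^sub>R \<alpha> \<beta> \<iota> :: 'c
  assumes bilinear_factorization:
    "bilinear_factorization_structure K k A \<mu>\<^sub>A \<eta>\<^sub>A B \<mu>\<^sub>B \<eta>\<^sub>B R \<mu>\<^sub>R \<eta>\<^sub>R \<alpha> \<beta> \<iota>"
begin

sublocale A: bicategory_monad K k A \<mu>\<^sub>A \<eta>\<^sub>A
  using bilinear_factorization by unfold_locales (simp add: bilinear_factorization_structure_def)
sublocale B: bicategory_monad K k B \<mu>\<^sub>B \<eta>\<^sub>B
  using bilinear_factorization by unfold_locales (simp add: bilinear_factorization_structure_def)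
sublocale R: bicategory_monad K k R \<mu>\<^sub>R \<eta>\<^sub>R
  using bilinear_factorization by unfold_locales (simp add: bilinear_factorization_structure_def)

notation R.convolution (infix "\<bullet>" 75)

abbreviation \<pi> where "\<pi> \<equiv> \<beta> \<bullet> \<alpha>"
abbreviation \<Psi> where "\<Psi> \<equiv> \<iota> \<cdot> (\<alpha> \<bullet> \<beta>)"

lemma structure_homs:
  "\<alpha> \<in> hom2 K A R" "\<beta> \<in> hom2 K B R" "\<iota> \<in> hom2 K R (B \<otimes> A)"
  using bilinear_factorization
  by (auto simp: bilinear_factorization_structure_def monad_hom_def bimodule_hom_def)

lemmas \<alpha>_hom = structure_homs(1)
lemmas \<beta>_hom = structure_homs(2)
lemmas \<iota>_hom = structure_homs(3)
lemmas \<pi>_hom = R.convolution_hom[OF \<beta>_hom \<alpha>_hom]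
lemmas \<alpha>\<beta>_hom = R.convolution_hom[OF \<alpha>_hom \<beta>_hom]
lemmas structure_simps [simp] = hom2D(1-3)[OF \<alpha>_hom] hom2D(1-3)[OF \<beta>_hom] hom2D(1-3)[OF \<iota>_hom]

lemma \<alpha>_mult: "\<alpha> \<cdot> \<mu>\<^sub>A = \<alpha> \<bullet> \<alpha>" and \<alpha>_unit: "\<alpha> \<cdot> \<eta>\<^sub>A = \<eta>\<^sub>R"
  and \<beta>_mult: "\<beta> \<cdot> \<mu>\<^sub>B = \<beta> \<bullet> \<beta>" and \<beta>_unit: "\<beta> \<cdot> \<eta>\<^sub>B = \<eta>\<^sub>R"
  and \<pi>_\<iota>: "\<pi> \<cdot> \<iota> = \<guillemotleft>R\<guillemotright>"
  using bilinear_factorization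
  by (auto simp: bilinear_factorization_structure_def monad_hom_def)

lemma \<pi>_\<iota>_cancel:
  assumes "x \<in> hom2 K X R"
  shows "\<pi> \<cdot> \<iota> \<cdot> x = x"
  using vcomp_assoc[OF assms \<iota>_hom \<pi>_hom] R.hom2_R[OF assms] by (simp only: \<pi>_\<iota>) simp

text \<open>
  Bilinearity of \<open>\<iota>\<close> in its usable form: read from right to left, the next two lemmas turn the free
  actions on \<open>B \<otimes> A\<close> into products in \<open>R\<close>, provided that the argument factors through \<open>\<iota>\<close>. The
  2-cell \<open>\<Psi>\<close> does.
\<close>

lemma \<iota>_\<beta>_linear:
  assumes "x \<in> hom2 K X R"
  shows "\<iota> \<cdot> (\<beta> \<bullet> x) = (\<mu>\<^sub>B \<star> \<guillemotleft>A\<guillemotright>) \<cdot> assoc_inv K B B A \<cdot> (\<guillemotleft>B\<guillemotright> \<star> (\<iota> \<cdot> x))"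
proof -
  note [simp] = R.hom2_R[OF assms]
  have "\<iota> \<cdot> (\<beta> \<bullet> x) = (\<iota> \<cdot> \<mu>\<^sub>R \<cdot> (\<beta> \<star> \<guillemotleft>R\<guillemotright>)) \<cdot> (\<guillemotleft>B\<guillemotright> \<star> x)"
    by (simp add: interchange_cells)
  also have "\<dots> = (((\<mu>\<^sub>B \<star> \<guillemotleft>A\<guillemotright>) \<cdot> assoc_inv K B B A) \<cdot> (\<guillemotleft>B\<guillemotright> \<star> \<iota>)) \<cdot> (\<guillemotleft>B\<guillemotright> \<star> x)"
    using bilinear_factorization
    by (simp only: bilinear_factorization_structure_def bimodule_hom_def)
  also have "\<dots> = (\<mu>\<^sub>B \<star> \<guillemotleft>A\<guillemotright>) \<cdot> assoc_inv K B B A \<cdot> (\<guillemotleft>B\<guillemotright> \<star> (\<iota> \<cdot> x))"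
    by (simp add: interchange_cells)
  finally show ?thesis .
qed

lemma \<iota>_\<alpha>_linear:
  assumes "x \<in> hom2 K X R"
  shows "\<iota> \<cdot> (x \<bullet> \<alpha>) = (\<guillemotleft>B\<guillemotright> \<star> \<mu>\<^sub>A) \<cdot> assoc K B A A \<cdot> ((\<iota> \<cdot> x) \<star> \<guillemotleft>A\<guillemotright>)"
proof -
  note [simp] = R.hom2_R[OF assms]
  have "\<iota> \<cdot> (x \<bullet> \<alpha>) = (\<iota> \<cdot> \<mu>\<^sub>R \<cdot> (\<guillemotleft>R\<guillemotright> \<star> \<alpha>)) \<cdot> (x \<star> \<guillemotleft>A\<guillemotright>)"
    by (simp add: interchange_cells)
  also have "\<dots> = (((\<guillemotleft>B\<guillemotright> \<star> \<mu>\<^sub>A) \<cdot> assoc K B A A) \<cdot> (\<iota> \<star> \<guillemotleft>A\<guillemotright>)) \<cdot> (x \<star> \<guillemotleft>A\<guillemotright>)"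
    using bilinear_factorization
    by (simp only: bilinear_factorization_structure_def bimodule_hom_def)
  also have "\<dots> = (\<guillemotleft>B\<guillemotright> \<star> \<mu>\<^sub>A) \<cdot> assoc K B A A \<cdot> ((\<iota> \<cdot> x) \<star> \<guillemotleft>A\<guillemotright>)"
    by (simp add: interchange_cells)
  finally show ?thesis .
qed

lemma wdl_left_eq: "wdl_left K A B \<mu>\<^sub>B \<Psi> = \<iota> \<cdot> (\<pi> \<bullet> \<beta>)"
proof -
  have "wdl_left K A B \<mu>\<^sub>B \<Psi> =
      ((\<mu>\<^sub>B \<star> \<guillemotleft>A\<guillemotright>) \<cdot> assoc_inv K B B A \<cdot> (\<guillemotleft>B\<guillemotright> \<star> \<Psi>)) \<cdot> assoc K B A B"
    by (simp add: wdl_left_def)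
  also have "\<dots> = (\<iota> \<cdot> (\<beta> \<bullet> (\<alpha> \<bullet> \<beta>))) \<cdot> assoc K B A B"
    by (simp only: \<iota>_\<beta>_linear[OF \<alpha>\<beta>_hom])
  also have "\<dots> = \<iota> \<cdot> (\<pi> \<bullet> \<beta>)"
    unfolding R.convolution_assoc[OF \<beta>_hom \<alpha>_hom \<beta>_hom] by simp
  finally show ?thesis .
qed

lemma wdl_right_eq: "wdl_right K A \<mu>\<^sub>A B \<Psi> = \<iota> \<cdot> (\<alpha> \<bullet> \<pi>)"
proof -
  have "wdl_right K A \<mu>\<^sub>A B \<Psi> =
      ((\<guillemotleft>B\<guillemotright> \<star> \<mu>\<^sub>A) \<cdot> assoc K B A A \<cdot> (\<Psi> \<star> \<guillemotleft>A\<guillemotright>)) \<cdot> assoc_inv K A B A"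
    by (simp add: wdl_right_def)
  also have "\<dots> = (\<iota> \<cdot> ((\<alpha> \<bullet> \<beta>) \<bullet> \<alpha>)) \<cdot> assoc_inv K A B A"
    by (simp only: \<iota>_\<alpha>_linear[OF \<alpha>\<beta>_hom])
  also have "\<dots> = \<iota> \<cdot> (\<alpha> \<bullet> \<pi>)"
    unfolding R.convolution_assoc_inv[OF \<alpha>_hom \<beta>_hom \<alpha>_hom, symmetric] by simp
  finally show ?thesis .
qed

text \<open>
  The two multiplications in \<open>\<mu>\<^sub>B \<star> \<mu>\<^sub>A\<close> can be done one at a time. Multiplying the \<open>A\<close>'s first,
  inside the left factor \<open>B\<close>, exhibits the composite as the left action of \<open>B\<close> on
  \<open>wdl_right = \<iota> \<cdot> (\<alpha> \<bullet> \<pi>)\<close>, to which left linearity of \<open>\<iota>\<close> applies again.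
\<close>

lemma wreath_mult_eq: "wreath_mult K A \<mu>\<^sub>A B \<mu>\<^sub>B \<Psi> = \<iota> \<cdot> (\<pi> \<bullet> \<pi>)"
proof -
  let ?c = "assoc K B A A \<cdot> (\<Psi> \<star> \<guillemotleft>A\<guillemotright>) \<cdot> assoc_inv K A B A"
  have "wreath_mult K A \<mu>\<^sub>A B \<mu>\<^sub>B \<Psi> =
      (\<mu>\<^sub>B \<star> \<guillemotleft>A\<guillemotright>) \<cdot> (((\<guillemotleft>B\<guillemotright> \<star> \<guillemotleft>B\<guillemotright>) \<star> \<mu>\<^sub>A) \<cdot> assoc_inv K B B (A \<otimes> A)) \<cdot>
      (\<guillemotleft>B\<guillemotright> \<star> ?c) \<cdot> assoc K B A (B \<otimes> A)"
  proof -
    have "\<mu>\<^sub>B \<star> \<mu>\<^sub>A = (\<mu>\<^sub>B \<star> \<guillemotleft>A\<guillemotright>) \<cdot> ((\<guillemotleft>B\<guillemotright> \<star> \<guillemotleft>B\<guillemotright>) \<star> \<mu>\<^sub>A)"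
      by (simp add: interchange_cells hcomp_id)
    then show ?thesis
      unfolding wreath_mult_def by simp
  qed
  also have "((\<guillemotleft>B\<guillemotright> \<star> \<guillemotleft>B\<guillemotright>) \<star> \<mu>\<^sub>A) \<cdot> assoc_inv K B B (A \<otimes> A) =
      assoc_inv K B B A \<cdot> (\<guillemotleft>B\<guillemotright> \<star> (\<guillemotleft>B\<guillemotright> \<star> \<mu>\<^sub>A))"
    by (rule assoc_inv_natural[symmetric]) (auto intro!: hom2I)
  also have "(\<mu>\<^sub>B \<star> \<guillemotleft>A\<guillemotright>) \<cdot> (assoc_inv K B B A \<cdot> (\<guillemotleft>B\<guillemotright> \<star> (\<guillemotleft>B\<guillemotright> \<star> \<mu>\<^sub>A))) \<cdot>
        (\<guillemotleft>B\<guillemotright> \<star> ?c) \<cdot> assoc K B A (B \<otimes> A) =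
      ((\<mu>\<^sub>B \<star> \<guillemotleft>A\<guillemotright>) \<cdot> assoc_inv K B B A \<cdot> ((\<guillemotleft>B\<guillemotright> \<star> (\<guillemotleft>B\<guillemotright> \<star> \<mu>\<^sub>A)) \<cdot> (\<guillemotleft>B\<guillemotright> \<star> ?c))) \<cdot>
      assoc K B A (B \<otimes> A)"
    by simp
  also have "(\<guillemotleft>B\<guillemotright> \<star> (\<guillemotleft>B\<guillemotright> \<star> \<mu>\<^sub>A)) \<cdot> (\<guillemotleft>B\<guillemotright> \<star> ?c) = \<guillemotleft>B\<guillemotright> \<star> wdl_right K A \<mu>\<^sub>A B \<Psi>"
    unfolding wdl_right_def by (subst interchange_cells) simp_all
  also have "\<dots> = \<guillemotleft>B\<guillemotright> \<star> (\<iota> \<cdot> (\<alpha> \<bullet> \<pi>))"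
    by (simp only: wdl_right_eq)
  also have "(\<mu>\<^sub>B \<star> \<guillemotleft>A\<guillemotright>) \<cdot> assoc_inv K B B A \<cdot> (\<guillemotleft>B\<guillemotright> \<star> (\<iota> \<cdot> (\<alpha> \<bullet> \<pi>))) = \<iota> \<cdot> (\<beta> \<bullet> (\<alpha> \<bullet> \<pi>))"
    by (simp only: \<iota>_\<beta>_linear[OF R.convolution_hom[OF \<alpha>_hom \<pi>_hom]])
  also have "(\<iota> \<cdot> (\<beta> \<bullet> (\<alpha> \<bullet> \<pi>))) \<cdot> assoc K B A (B \<otimes> A) = \<iota> \<cdot> (\<pi> \<bullet> \<pi>)"
    unfolding R.convolution_assoc[OF \<beta>_hom \<alpha>_hom \<pi>_hom] by simp
  finally show ?thesis .
qed

text \<open>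
  Inserting the units of \<open>A\<close> and \<open>B\<close> in the middle of \<open>\<pi> \<bullet> \<pi> = (\<beta> \<bullet> \<alpha>) \<bullet> (\<beta> \<bullet> \<alpha>)\<close> turns the two inner
  factors into \<open>\<eta>\<^sub>R\<close>, which leaves \<open>\<beta> \<bullet> \<alpha>\<close>.
\<close>

lemma wreath_idem_eq: "wreath_idem K A \<mu>\<^sub>A \<eta>\<^sub>A B \<mu>\<^sub>B \<eta>\<^sub>B \<Psi> = \<iota> \<cdot> \<pi>"
proof -
  have "\<pi> \<cdot> (\<guillemotleft>B\<guillemotright> \<star> \<eta>\<^sub>A) = (\<beta> \<cdot> \<guillemotleft>B\<guillemotright>) \<bullet> (\<alpha> \<cdot> \<eta>\<^sub>A)"
    by (rule R.convolution_precomp[OF \<beta>_hom \<alpha>_hom B.id_hom A.unit_hom])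
  then have right: "\<pi> \<cdot> (\<guillemotleft>B\<guillemotright> \<star> \<eta>\<^sub>A) = \<beta> \<cdot> runit K B"
    by (simp add: \<alpha>_unit R.convolution_unit_right[OF \<beta>_hom])
  have "\<pi> \<cdot> (\<eta>\<^sub>B \<star> \<guillemotleft>A\<guillemotright>) = (\<beta> \<cdot> \<eta>\<^sub>B) \<bullet> (\<alpha> \<cdot> \<guillemotleft>A\<guillemotright>)"
    by (rule R.convolution_precomp[OF \<beta>_hom \<alpha>_hom B.unit_hom A.id_hom])
  then have left: "\<pi> \<cdot> (\<eta>\<^sub>B \<star> \<guillemotleft>A\<guillemotright>) = \<alpha> \<cdot> lunit K A"
    by (simp add: \<beta>_unit R.convolution_unit_left[OF \<alpha>_hom])
  have "wreath_idem K A \<mu>\<^sub>A \<eta>\<^sub>A B \<mu>\<^sub>B \<eta>\<^sub>B \<Psi> = \<iota> \<cdot> ((\<pi> \<bullet> \<pi>) \<cdot>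
      ((\<guillemotleft>B\<guillemotright> \<star> \<eta>\<^sub>A) \<star> (\<eta>\<^sub>B \<star> \<guillemotleft>A\<guillemotright>))) \<cdot> (runit_inv K B \<star> lunit_inv K A)"
    unfolding wreath_idem_def wreath_mult_eq by simp
  also have "(\<pi> \<bullet> \<pi>) \<cdot> ((\<guillemotleft>B\<guillemotright> \<star> \<eta>\<^sub>A) \<star> (\<eta>\<^sub>B \<star> \<guillemotleft>A\<guillemotright>)) = (\<beta> \<cdot> runit K B) \<bullet> (\<alpha> \<cdot> lunit K A)"
    unfolding right[symmetric] left[symmetric]
    by (rule R.convolution_precomp[OF \<pi>_hom \<pi>_hom]) (auto intro!: hom2I)
  also have "\<dots> \<cdot> (runit_inv K B \<star> lunit_inv K A) = \<pi>"
    by (simp add: interchange_cells)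
  finally show ?thesis .
qed

text \<open>
  The first axiom reduces to \<open>(\<alpha> \<bullet> \<alpha>) \<bullet> \<beta> = \<alpha> \<bullet> (\<alpha> \<bullet> \<beta>)\<close>, the second to
  \<open>\<alpha> \<bullet> (\<beta> \<bullet> \<beta>) = (\<alpha> \<bullet> \<beta>) \<bullet> \<beta>\<close>, up to associators, and the third to \<open>\<pi> \<bullet> \<eta>\<^sub>R = \<pi> = \<eta>\<^sub>R \<bullet> \<pi>\<close>, up to
  unitors.
\<close>

theorem weak_distributive_law: "weak_distributive_law K k A \<mu>\<^sub>A \<eta>\<^sub>A B \<mu>\<^sub>B \<eta>\<^sub>B \<Psi>"
proof -
  have \<Psi>_hom: "\<Psi> \<in> hom2 K (A \<otimes> B) (B \<otimes> A)"
    by (auto intro!: hom2I)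
  have pre: "(\<iota> \<cdot> (x \<bullet> y)) \<cdot> (f \<star> g) = \<iota> \<cdot> ((x \<cdot> f) \<bullet> (y \<cdot> g))"
    if "x \<in> hom2 K X R" "y \<in> hom2 K Y R" "f \<in> hom2 K X' X" "g \<in> hom2 K Y' Y" for x y f g X Y X' Y'
    unfolding R.convolution_precomp[OF that, symmetric]
    using hom2D[OF that(1)] hom2D[OF that(2)] hom2D[OF that(3)] hom2D[OF that(4)] by simp
  have \<mu>A: "\<mu>\<^sub>A \<in> hom2 K (A \<otimes> A) A" and \<mu>B: "\<mu>\<^sub>B \<in> hom2 K (B \<otimes> B) B"
    by (auto intro!: hom2I)
  have "\<Psi> \<cdot> (\<mu>\<^sub>A \<star> \<guillemotleft>B\<guillemotright>) = \<iota> \<cdot> ((\<alpha> \<bullet> \<alpha>) \<bullet> \<beta>)"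
    by (simp only: pre[OF \<alpha>_hom \<beta>_hom \<mu>A B.id_hom] \<alpha>_mult) simp
  also have "\<dots> = (\<iota> \<cdot> (\<alpha> \<bullet> (\<alpha> \<bullet> \<beta>))) \<cdot> assoc K A A B"
    unfolding R.convolution_assoc[OF \<alpha>_hom \<alpha>_hom \<beta>_hom] by simp
  also have "\<iota> \<cdot> (\<alpha> \<bullet> (\<alpha> \<bullet> \<beta>)) = (\<iota> \<cdot> (\<alpha> \<bullet> \<pi>)) \<cdot> (\<guillemotleft>A\<guillemotright> \<star> \<Psi>)"
    by (simp only: pre[OF \<alpha>_hom \<pi>_hom A.id_hom \<Psi>_hom] \<pi>_\<iota>_cancel[OF \<alpha>\<beta>_hom]) simp
  also have "\<dots> \<cdot> assoc K A A B = (\<iota> \<cdot> (\<alpha> \<bullet> \<pi>)) \<cdot> (\<guillemotleft>A\<guillemotright> \<star> \<Psi>) \<cdot> assoc K A A B"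
    by simp
  finally have mult_A: "\<Psi> \<cdot> (\<mu>\<^sub>A \<star> \<guillemotleft>B\<guillemotright>) =
      wdl_right K A \<mu>\<^sub>A B \<Psi> \<cdot> (\<guillemotleft>A\<guillemotright> \<star> \<Psi>) \<cdot> assoc K A A B"
    unfolding wdl_right_eq .
  have "\<Psi> \<cdot> (\<guillemotleft>A\<guillemotright> \<star> \<mu>\<^sub>B) = \<iota> \<cdot> (\<alpha> \<bullet> (\<beta> \<bullet> \<beta>))"
    by (simp only: pre[OF \<alpha>_hom \<beta>_hom A.id_hom \<mu>B] \<beta>_mult) simp
  also have "\<dots> = (\<iota> \<cdot> ((\<alpha> \<bullet> \<beta>) \<bullet> \<beta>)) \<cdot> assoc_inv K A B B"
    unfolding R.convolution_assoc_inv[OF \<alpha>_hom \<beta>_hom \<beta>_hom, symmetric] by simp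
  also have "\<iota> \<cdot> ((\<alpha> \<bullet> \<beta>) \<bullet> \<beta>) = (\<iota> \<cdot> (\<pi> \<bullet> \<beta>)) \<cdot> (\<Psi> \<star> \<guillemotleft>B\<guillemotright>)"
    by (simp only: pre[OF \<pi>_hom \<beta>_hom \<Psi>_hom B.id_hom] \<pi>_\<iota>_cancel[OF \<alpha>\<beta>_hom]) simp
  also have "\<dots> \<cdot> assoc_inv K A B B = (\<iota> \<cdot> (\<pi> \<bullet> \<beta>)) \<cdot> (\<Psi> \<star> \<guillemotleft>B\<guillemotright>) \<cdot> assoc_inv K A B B"
    by simp
  finally have mult_B: "\<Psi> \<cdot> (\<guillemotleft>A\<guillemotright> \<star> \<mu>\<^sub>B) =
      wdl_left K A B \<mu>\<^sub>B \<Psi> \<cdot> (\<Psi> \<star> \<guillemotleft>B\<guillemotright>) \<cdot> assoc_inv K A B B"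
    unfolding wdl_left_eq .
  have BA: "\<guillemotleft>B \<otimes> A\<guillemotright> \<in> hom2 K (B \<otimes> A) (B \<otimes> A)"
    by (simp add: id2_hom)
  have "(\<iota> \<cdot> (\<pi> \<bullet> \<beta>)) \<cdot> (\<guillemotleft>B \<otimes> A\<guillemotright> \<star> \<eta>\<^sub>B) = \<iota> \<cdot> (\<pi> \<bullet> \<eta>\<^sub>R)"
    by (simp only: pre[OF \<pi>_hom \<beta>_hom BA B.unit_hom] \<beta>_unit) simp
  also have "\<dots> = (\<iota> \<cdot> \<pi>) \<cdot> runit K (B \<otimes> A)"
    unfolding R.convolution_unit_right[OF \<pi>_hom] by simp
  finally have "((\<iota> \<cdot> (\<pi> \<bullet> \<beta>)) \<cdot> (\<guillemotleft>B \<otimes> A\<guillemotright> \<star> \<eta>\<^sub>B)) \<cdot> runit_inv K (B \<otimes> A) = \<iota> \<cdot> \<pi>"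
    by (simp only:) (rule vcomp_inv2_cancel; simp)
  then have unit_B: "wdl_left K A B \<mu>\<^sub>B \<Psi> \<cdot> (\<guillemotleft>B \<otimes> A\<guillemotright> \<star> \<eta>\<^sub>B) \<cdot> runit_inv K (B \<otimes> A) = \<iota> \<cdot> \<pi>"
    unfolding wdl_left_eq by simp
  have "(\<iota> \<cdot> (\<alpha> \<bullet> \<pi>)) \<cdot> (\<eta>\<^sub>A \<star> \<guillemotleft>B \<otimes> A\<guillemotright>) = \<iota> \<cdot> (\<eta>\<^sub>R \<bullet> \<pi>)"
    by (simp only: pre[OF \<alpha>_hom \<pi>_hom A.unit_hom BA] \<alpha>_unit) simp
  also have "\<dots> = (\<iota> \<cdot> \<pi>) \<cdot> lunit K (B \<otimes> A)"
    unfolding R.convolution_unit_left[OF \<pi>_hom] by simp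
  finally have "((\<iota> \<cdot> (\<alpha> \<bullet> \<pi>)) \<cdot> (\<eta>\<^sub>A \<star> \<guillemotleft>B \<otimes> A\<guillemotright>)) \<cdot> lunit_inv K (B \<otimes> A) = \<iota> \<cdot> \<pi>"
    by (simp only:) (rule vcomp_inv2_cancel; simp)
  then have unit_A: "wdl_right K A \<mu>\<^sub>A B \<Psi> \<cdot> (\<eta>\<^sub>A \<star> \<guillemotleft>B \<otimes> A\<guillemotright>) \<cdot> lunit_inv K (B \<otimes> A) = \<iota> \<cdot> \<pi>"
    unfolding wdl_right_eq by simp
  show ?thesis
    unfolding weak_distributive_law_def
    using A.monad B.monad \<Psi>_hom mult_A mult_B unit_A unit_B by simp
qed

section \<open>The weak wreath product\<close>

lemma wreath_idem_splitting:
  "is_splitting K (B \<otimes> A) (wreath_idem K A \<mu>\<^sub>A \<eta>\<^sub>A B \<mu>\<^sub>B \<eta>\<^sub>B \<Psi>) R \<pi> \<iota>"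
  unfolding is_splitting_def wreath_idem_eq
  using \<pi>_hom \<iota>_hom \<pi>_\<iota> by (intro conjI) (assumption | rule refl)+

text \<open>
  Two splittings of one idempotent are isomorphic by the composite of the injection of one with the
  projection of the other, here \<open>p \<cdot> \<iota>\<close>. Since \<open>wreath_mult\<close> is \<open>\<iota> \<cdot> (\<pi> \<bullet> \<pi>)\<close>, the weak wreath
  multiplication \<open>p \<cdot> \<iota> \<cdot> (\<pi> \<bullet> \<pi>) \<cdot> (i \<star> i)\<close> is the multiplication of \<open>R\<close> transported along it.
\<close>

theorem isomorphic_weak_wreath_product:
  assumes "is_splitting K (B \<otimes> A) (wreath_idem K A \<mu>\<^sub>A \<eta>\<^sub>A B \<mu>\<^sub>B \<eta>\<^sub>B \<Psi>) P p i"
  shows "isomorphic_monads K k R \<mu>\<^sub>R \<eta>\<^sub>R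
    P (weak_wreath_mult K A \<mu>\<^sub>A B \<mu>\<^sub>B \<Psi> p i) (weak_wreath_unit K k \<eta>\<^sub>A \<eta>\<^sub>B p)"
proof -
  have p: "p \<in> hom2 K (B \<otimes> A) P" and i: "i \<in> hom2 K P (B \<otimes> A)"
    and pi: "p \<cdot> i = \<guillemotleft>P\<guillemotright>" and ip: "i \<cdot> p = \<iota> \<cdot> \<pi>"
    using assms by (simp_all add: is_splitting_def wreath_idem_eq)
  note [simp] = hom2D[OF p] hom2D(1-3)[OF i]
  \<comment> \<open>\<open>p\<close> factors through \<open>\<pi>\<close>, so the unit defined by \<open>p\<close> is the image of \<open>\<eta>\<^sub>R\<close> under \<open>p \<cdot> \<iota>\<close>.\<close>
  have "p = (p \<cdot> i) \<cdot> p"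
    unfolding pi by simp
  also have "\<dots> = p \<cdot> (i \<cdot> p)"
    by simp
  finally have p_eq: "p = (p \<cdot> \<iota>) \<cdot> \<pi>"
    unfolding ip by simp
  have "(\<pi> \<cdot> i) \<cdot> (p \<cdot> \<iota>) = \<pi> \<cdot> (i \<cdot> p) \<cdot> \<iota>"
    by simp
  also have "\<dots> = (\<pi> \<cdot> \<iota>) \<cdot> (\<pi> \<cdot> \<iota>)"
    unfolding ip by simp
  finally have inv1: "(\<pi> \<cdot> i) \<cdot> (p \<cdot> \<iota>) = \<guillemotleft>R\<guillemotright>"
    unfolding \<pi>_\<iota> by simp
  have "(p \<cdot> \<iota>) \<cdot> (\<pi> \<cdot> i) = ((p \<cdot> \<iota>) \<cdot> \<pi>) \<cdot> i"
    by simp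
  then have inv2: "(p \<cdot> \<iota>) \<cdot> (\<pi> \<cdot> i) = \<guillemotleft>P\<guillemotright>"
    by (simp only: p_eq[symmetric] pi)
  have "weak_wreath_mult K A \<mu>\<^sub>A B \<mu>\<^sub>B \<Psi> p i = (p \<cdot> \<iota>) \<cdot> ((\<pi> \<bullet> \<pi>) \<cdot> (i \<star> i))"
    unfolding weak_wreath_mult_def wreath_mult_eq by simp
  also have "\<dots> = (p \<cdot> \<iota>) \<cdot> ((\<pi> \<cdot> i) \<bullet> (\<pi> \<cdot> i))"
    by (simp only: R.convolution_precomp[OF \<pi>_hom \<pi>_hom i i])
  finally have mult: "weak_wreath_mult K A \<mu>\<^sub>A B \<mu>\<^sub>B \<Psi> p i = (p \<cdot> \<iota>) \<cdot> ((\<pi> \<cdot> i) \<bullet> (\<pi> \<cdot> i))" .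
  have "\<pi> \<cdot> (\<eta>\<^sub>B \<star> \<eta>\<^sub>A) = \<eta>\<^sub>R \<bullet> \<eta>\<^sub>R"
    by (simp only: R.convolution_precomp[OF \<beta>_hom \<alpha>_hom B.unit_hom A.unit_hom] \<alpha>_unit \<beta>_unit)
  then have "(\<pi> \<cdot> (\<eta>\<^sub>B \<star> \<eta>\<^sub>A)) \<cdot> lunit_inv K (id1 K k) = \<eta>\<^sub>R"
    by (simp only: R.convolution_unit_left[OF R.unit_hom]) (rule vcomp_inv2_cancel; simp)
  moreover have "weak_wreath_unit K k \<eta>\<^sub>A \<eta>\<^sub>B p =
      (p \<cdot> \<iota>) \<cdot> ((\<pi> \<cdot> (\<eta>\<^sub>B \<star> \<eta>\<^sub>A)) \<cdot> lunit_inv K (id1 K k))"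
    unfolding weak_wreath_unit_def by (subst p_eq) simp
  ultimately have unit: "weak_wreath_unit K k \<eta>\<^sub>A \<eta>\<^sub>B p = (p \<cdot> \<iota>) \<cdot> \<eta>\<^sub>R"
    by simp
  show ?thesis
    unfolding mult unit
  proof (rule R.isomorphic_monads_transport[OF _ _ inv1 inv2])
    show "p \<cdot> \<iota> \<in> hom2 K R P"
      by (rule vcomp_hom[OF \<iota>_hom p])
    show "\<pi> \<cdot> i \<in> hom2 K P R"
      by (rule vcomp_hom[OF i \<pi>_hom])
  qed
qed

end

theorem theorem1p8:
  fixes K :: "('o, 'm, 'c, 'x) bicat_scheme" (structure)
    and k :: 'o and A B R :: 'm
    and \<mu>\<^sub>A \<eta>\<^sub>A \<mu>\<^sub>B \<eta>\<^sub>B \<mu>\<^sub>R \<eta>\<^sub>R \<alpha> \<beta> \<iota> \<Psi> :: 'c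
  assumes "bicategory K"
    and "bilinear_factorization_structure K k A \<mu>\<^sub>A \<eta>\<^sub>A B \<mu>\<^sub>B \<eta>\<^sub>B R \<mu>\<^sub>R \<eta>\<^sub>R \<alpha> \<beta> \<iota>"
    and "\<Psi> = \<iota> \<cdot> \<mu>\<^sub>R \<cdot> (\<alpha> \<star> \<beta>)"
  shows "weak_distributive_law K k A \<mu>\<^sub>A \<eta>\<^sub>A B \<mu>\<^sub>B \<eta>\<^sub>B \<Psi> \<and>
    splits K (B \<otimes> A) (wreath_idem K A \<mu>\<^sub>A \<eta>\<^sub>A B \<mu>\<^sub>B \<eta>\<^sub>B \<Psi>) \<and>
    (\<forall>P p i. is_splitting K (B \<otimes> A) (wreath_idem K A \<mu>\<^sub>A \<eta>\<^sub>A B \<mu>\<^sub>B \<eta>\<^sub>B \<Psi>) P p i \<longrightarrow>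
       isomorphic_monads K k R \<mu>\<^sub>R \<eta>\<^sub>R
         P (weak_wreath_mult K A \<mu>\<^sub>A B \<mu>\<^sub>B \<Psi> p i) (weak_wreath_unit K k \<eta>\<^sub>A \<eta>\<^sub>B p))"
proof -
  interpret bilinear_factorization K k A \<mu>\<^sub>A \<eta>\<^sub>A B \<mu>\<^sub>B \<eta>\<^sub>B R \<mu>\<^sub>R \<eta>\<^sub>R \<alpha> \<beta> \<iota>
    using assms(1,2) by (simp add: bilinear_factorization_def bilinear_factorization_axioms_def)
  show ?thesis
    unfolding assms(3) splits_def
    using weak_distributive_law wreath_idem_splitting isomorphic_weak_wreath_product by blast
qed

end
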